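(* For every simple oriented matroid $\mathcal M=(E,\mathcal L)$, $$\operatorname{Mag}(G(\mathcal M);q)=\sum_{F\in\mathcal L}(-1)^{r(\mathcal M_F)}q^{|Z(F)|}\operatorname{Mag}(G(\mathcal M_F);q).$$
   Context: All oriented matroids are finite. For $X,Y\in\{+,0,-\}^E$ put $(X\circ Y)_e=X_e$ if $X_e\ne0$, else $Y_e$, and $S(X,Y)=\{e:X_e=-Y_e\ne0\}$. An oriented matroid $(E,\mathcal L)$ has covector set $\mathcal L\subseteq\{+,0,-\}^E$ containing $0$, closed under negation and $\circ$, and satisfying strong elimination: if $X,Y\in\mathcal L$, $e\in S(X,Y)$, there is $Z\in\mathcal L$ with $Z_e=0$ and $Z_f=(X\circ Y)_f$ for $f\notin S(X,Y)$. The flats of the underlying matroid are the zero sets $Z(X)=\{e:X_e=0\}$; the rank $r(\mathcal M)$ is that of the underlying matroid; $\mathcal M$ is simple if the underlying matroid is. For $F\in\mathcal L$, the localization $\mathcal M_F=\mathcal M|Z(F)$ is the oriented matroid on $Z(F)$ with covectors $X|_{Z(F)}$, $X\in\mathcal L$. Topes are the covectors maximal for $X\le Y\iff X_e\in\{0,Y_e\}$ for all $e$. For simple $\mathcal M$ the tope graph $G(\mathcal M)$ joins topes differing in exactly one coordinate, with distance $d(B,C)=|S(B,C)|$. For a finite connected graph $G$, $\operatorname{Mag}(G;q)=\mathbf 1^{\mathsf T}K_G(q)^{-1}\mathbf 1$ with $K_G(q)=(q^{d(B,C)})_{B,C\in V(G)}$. The empty oriented matroid (ground set $\varnothing$) has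 one tope and magnitude $1$. *)

theory Defs
  imports Complex_Main "HOL-Computational_Algebra.Polynomial"
    "HOL-Computational_Algebra.Fraction_Field"
begin

section \<open>Sign vectors\<close>

text \<open>
  A sign vector on \<open>E\<close> is a function with values in \<open>{-1, 0, 1}\<close> that vanishes outside \<open>E\<close>, so that
  equality of functions is equality of sign vectors on \<open>E\<close>.
\<close>

definition sign_vectors :: "'e set \<Rightarrow> ('e \<Rightarrow> int) set" where
  "sign_vectors E = {X. (\<forall>e\<in>E. X e \<in> {-1, 0, 1}) \<and> (\<forall>e. e \<notin> E \<longrightarrow> X e = 0)}"

definition comp_sv :: "('e \<Rightarrow> int) \<Rightarrow> ('e \<Rightarrow> int) \<Rightarrow> ('e \<Rightarrow> int)" where
  "comp_sv X Y = (\<lambda>e. if X e \<noteq> 0 then X e else Y e)"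

definition neg_sv :: "('e \<Rightarrow> int) \<Rightarrow> ('e \<Rightarrow> int)" where
  "neg_sv X = (\<lambda>e. - X e)"

definition restrict_sv :: "('e \<Rightarrow> int) \<Rightarrow> 'e set \<Rightarrow> ('e \<Rightarrow> int)" where
  "restrict_sv X A = (\<lambda>e. if e \<in> A then X e else 0)"

definition separator :: "('e \<Rightarrow> int) \<Rightarrow> ('e \<Rightarrow> int) \<Rightarrow> 'e set" where
  "separator X Y = {e. X e = - Y e \<and> X e \<noteq> 0}"

definition le_sv :: "('e \<Rightarrow> int) \<Rightarrow> ('e \<Rightarrow> int) \<Rightarrow> bool" where
  "le_sv X Y \<longleftrightarrow> (\<forall>e. X e \<in> {0, Y e})"

definition zero_set :: "'e set \<Rightarrow> ('e \<Rightarrow> int) \<Rightarrow> 'e set" where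
  "zero_set E X = {e \<in> E. X e = 0}"


section \<open>Oriented matroids\<close>

locale oriented_matroid =
  fixes E :: "'e set" and L :: "('e \<Rightarrow> int) set"
  assumes finite_ground: "finite E"
    and covectors: "L \<subseteq> sign_vectors E"
    and zero_covector: "(\<lambda>_. 0) \<in> L"
    and neg_closed: "X \<in> L \<Longrightarrow> neg_sv X \<in> L"
    and comp_closed: "X \<in> L \<Longrightarrow> Y \<in> L \<Longrightarrow> comp_sv X Y \<in> L"
    and strong_elimination: "X \<in> L \<Longrightarrow> Y \<in> L \<Longrightarrow> e \<in> separator X Y \<Longrightarrow>
      \<exists>Z\<in>L. Z e = 0 \<and> (\<forall>f \<in> E - separator X Y. Z f = comp_sv X Y f)"

text \<open>The underlying matroid is given by its flats; closure, independent sets and rank are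
  derived from them.\<close>

definition om_flats :: "'e set \<Rightarrow> ('e \<Rightarrow> int) set \<Rightarrow> 'e set set" where
  "om_flats E L = zero_set E ` L"

definition om_closure :: "'e set \<Rightarrow> ('e \<Rightarrow> int) set \<Rightarrow> 'e set \<Rightarrow> 'e set" where
  "om_closure E L A = \<Inter> {F \<in> om_flats E L. A \<subseteq> F}"

definition om_indep :: "'e set \<Rightarrow> ('e \<Rightarrow> int) set \<Rightarrow> 'e set \<Rightarrow> bool" where
  "om_indep E L A \<longleftrightarrow> A \<subseteq> E \<and> (\<forall>a\<in>A. a \<notin> om_closure E L (A - {a}))"

definition om_rank :: "'e set \<Rightarrow> ('e \<Rightarrow> int) set \<Rightarrow> nat" where
  "om_rank E L = Max (card ` {A. om_indep E L A})"

text \<open>No loops (dependent singletons) and no parallel elements (dependent pairs).\<close>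

definition om_simple :: "'e set \<Rightarrow> ('e \<Rightarrow> int) set \<Rightarrow> bool" where
  "om_simple E L \<longleftrightarrow> (\<forall>e\<in>E. om_indep E L {e}) \<and> (\<forall>e\<in>E. \<forall>f\<in>E. om_indep E L {e, f})"

text \<open>The covectors of the localization at \<open>F\<close>; its ground set is \<open>zero_set E F\<close>.\<close>

definition localization :: "'e set \<Rightarrow> ('e \<Rightarrow> int) set \<Rightarrow> ('e \<Rightarrow> int) \<Rightarrow> ('e \<Rightarrow> int) set" where
  "localization E L F = (\<lambda>X. restrict_sv X (zero_set E F)) ` L"

definition topes :: "('e \<Rightarrow> int) set \<Rightarrow> ('e \<Rightarrow> int) set" where
  "topes L = {B \<in> L. \<forall>X\<in>L. le_sv B X \<longrightarrow> X = B}"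


section \<open>Graphs and magnitude\<close>

text \<open>A graph is a vertex set together with a (symmetric, irreflexive) adjacency relation on it.\<close>

type_synonym 'v graph = "'v set \<times> ('v \<times> 'v) set"

definition tope_graph :: "('e \<Rightarrow> int) set \<Rightarrow> ('e \<Rightarrow> int) graph" where
  "tope_graph L =
    (topes L, {(B, C). B \<in> topes L \<and> C \<in> topes L \<and> card {e. B e \<noteq> C e} = 1})"

text \<open>
  Length of a shortest walk; meaningful if \<open>u\<close> and \<open>v\<close> lie in one component. In the tope graph of a
  simple oriented matroid this is \<open>card (separator u v)\<close>.
\<close>

definition graph_dist :: "'v graph \<Rightarrow> 'v \<Rightarrow> 'v \<Rightarrow> nat" where
  "graph_dist G u v = (LEAST n. (u, v) \<in> snd G ^^ n)"

text \<open>The inverse of a square matrix with rows and columns indexed by a finite set \<open>V\<close>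
  (extended by \<open>0\<close> outside \<open>V\<close>, to make it unique as a function).\<close>

definition inverse_on :: "'v set \<Rightarrow> ('v \<Rightarrow> 'v \<Rightarrow> 'a::field) \<Rightarrow> ('v \<Rightarrow> 'v \<Rightarrow> 'a)" where
  "inverse_on V K = (THE N.
     (\<forall>u v. u \<notin> V \<or> v \<notin> V \<longrightarrow> N u v = 0) \<and>
     (\<forall>u\<in>V. \<forall>v\<in>V. (\<Sum>w\<in>V. K u w * N w v) = (if u = v then 1 else 0)) \<and>
     (\<forall>u\<in>V. \<forall>v\<in>V. (\<Sum>w\<in>V. N u w * K w v) = (if u = v then 1 else 0)))"

text \<open>
  Magnitude is a rational function of the indeterminate \<open>q\<close>, i.e. an element of the field of
  fractions of \<open>rat poly\<close>. The matrix \<open>K\<^sub>G(q)\<close> of a finite connected graph is always invertible over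
  this field, since its entries are polynomials and it becomes the identity matrix at \<open>q = 0\<close>.
\<close>

definition qvar :: "rat poly fract" where
  "qvar = Fract [:0, 1:] 1"

definition similarity_matrix :: "'v graph \<Rightarrow> 'v \<Rightarrow> 'v \<Rightarrow> rat poly fract" where
  "similarity_matrix G = (\<lambda>u v. qvar ^ graph_dist G u v)"

definition magnitude :: "'v graph \<Rightarrow> rat poly fract" where
  "magnitude G = (\<Sum>u\<in>fst G. \<Sum>v\<in>fst G. inverse_on (fst G) (similarity_matrix G) u v)"

end

theory Submission
  imports Defs "Jordan_Normal_Form.Determinant"
begin

text \<open>
  Let \<open>K\<close> be the similarity matrix of the tope graph and, for a covector \<open>F\<close>, let \<open>w\<^sub>F\<close> be a weighting
  of the tope graph of the localization at \<open>F\<close>, viewed as a function on the star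
  \<open>{C. F \<le> C}\<close> of \<open>F\<close>. The star is gated: \<open>d(B, C) = |S(B, F)| + d(F \<circ> B, C)\<close> for
  \<open>C \<ge> F\<close>. Hence \<open>w = (\<Sum>F. (-1)^r(M\<^sub>F) q^|Z(F)| w\<^sub>F)\<close> satisfies
  \<open>(K w)(B) = (\<Sum>F. (-1)^r(M\<^sub>F) q^|{e. F e \<noteq> B e}|)\<close>, and it remains to see that this is \<open>1\<close>.
  Expanding \<open>q^|{e. F e \<noteq> B e}| = (\<Prod>e. (1 - q) [F e = B e] + q)\<close> reduces this to
  \<open>(\<Sum>F | F = B on P. (-1)^r(M\<^sub>F)) = 1\<close> for all \<open>P \<subseteq> E\<close>. This sum does not change under deletion of an
  element outside \<open>P\<close>, because the sign of a covector at the deleted element either is determined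
  or can be chosen freely among \<open>+, 0, -\<close>; and for \<open>P = E\<close> the only summand is \<open>1\<close>.
\<close>

section \<open>The rank function of the underlying matroid\<close>

text \<open>Closure in the matroid whose flats are the zero sets of covectors. It refers to no
  ground set, so that one closure on \<open>L\<close> serves all restrictions.\<close>

definition vanishing_closure :: "('e \<Rightarrow> int) set \<Rightarrow> 'e set \<Rightarrow> 'e set" where
  "vanishing_closure L A = {e. \<forall>X\<in>L. (\<forall>a\<in>A. X a = 0) \<longrightarrow> X e = 0}"

definition independent_in :: "('e \<Rightarrow> int) set \<Rightarrow> 'e set \<Rightarrow> bool" where
  "independent_in L I \<longleftrightarrow> (\<forall>a\<in>I. a \<notin> vanishing_closure L (I - {a}))"

definition rank_in :: "('e \<Rightarrow> int) set \<Rightarrow> 'e set \<Rightarrow> nat" where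
  "rank_in L A = Max (card ` {I. I \<subseteq> A \<and> independent_in L I})"

lemma vanishing_closure_extensive: "e \<in> A \<Longrightarrow> e \<in> vanishing_closure L A"
  by (auto simp: vanishing_closure_def)

lemma vanishing_closure_least:
  assumes "A \<subseteq> vanishing_closure L B"
  shows "vanishing_closure L A \<subseteq> vanishing_closure L B"
  using assms unfolding vanishing_closure_def by blast

lemma vanishing_closure_mono: "A \<subseteq> B \<Longrightarrow> vanishing_closure L A \<subseteq> vanishing_closure L B"
  unfolding vanishing_closure_def by blast

lemma independent_in_subset: "independent_in L I \<Longrightarrow> J \<subseteq> I \<Longrightarrow> independent_in L J"
  unfolding independent_in_def using vanishing_closure_mono[of "J - {_}" "I - {_}" L] by blast

context oriented_matroid
begin

lemma covector_outside: "X \<in> L \<Longrightarrow> e \<notin> E \<Longrightarrow> X e = 0"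
  using covectors by (auto simp: sign_vectors_def)

lemma covector_values: "X \<in> L \<Longrightarrow> X e \<in> {-1, 0, 1}"
  using covectors covector_outside[of X e] by (cases "e \<in> E") (auto simp: sign_vectors_def)

lemma finite_covectors: "finite L"
proof (rule finite_subset)
  show "L \<subseteq> {X. \<forall>e. (e \<in> E \<longrightarrow> X e \<in> {-1, 0, 1}) \<and> (e \<notin> E \<longrightarrow> X e = 0)}"
    using covectors unfolding sign_vectors_def by blast
  show "finite {X. \<forall>e. (e \<in> E \<longrightarrow> X e \<in> {-1, 0, 1 :: int}) \<and> (e \<notin> E \<longrightarrow> X e = 0)}"
    by (rule finite_set_of_finite_funs) (simp_all add: finite_ground)
qed

text \<open>Covectors vanish outside \<open>E\<close>, so the agreement given by strong elimination
  extends to all elements.\<close>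

lemma elimination_opposite:
  assumes "X \<in> L" "Y \<in> L" "X e = - Y e" "X e \<noteq> 0"
  obtains Z where "Z \<in> L" "Z e = 0" "\<And>f. \<not> (X f = - Y f \<and> X f \<noteq> 0) \<Longrightarrow> Z f = comp_sv X Y f"
proof -
  obtain Z where Z: "Z \<in> L" "Z e = 0" "\<forall>f \<in> E - separator X Y. Z f = comp_sv X Y f"
    using strong_elimination[of X Y e] assms by (auto simp: separator_def)
  have "Z f = comp_sv X Y f" if "\<not> (X f = - Y f \<and> X f \<noteq> 0)" for f
    using Z that covector_outside[of X f] covector_outside[of Y f] covector_outside[of Z f] assms(1,2)
    by (cases "f \<in> E") (auto simp: separator_def comp_sv_def)
  with Z that show thesis by blast
qed

text \<open>Either \<open>X\<close> or its negative qualifies. This prepares an elimination at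
  \<open>f\<close> against \<open>Y\<close>.\<close>

lemma opposite_sign_covector:
  assumes "X \<in> L" "X f \<noteq> 0" "Y \<in> L" "Y f \<noteq> 0"
  obtains X' where "X' \<in> L" "X' f = - Y f" "\<And>e. X e = 0 \<Longrightarrow> X' e = 0"
proof (cases "X f = - Y f")
  case True
  thus ?thesis using that assms(1) by blast
next
  case False
  hence "X f = Y f"
    using covector_values[OF assms(1), of f] covector_values[OF assms(3), of f] assms(2,4) by auto
  thus ?thesis using that[of "neg_sv X"] neg_closed[OF assms(1)] by (auto simp: neg_sv_def)
qed

text \<open>If the conclusion fails, some covector \<open>X\<close> vanishes on \<open>A\<close> and
  \<open>e\<close> but not at \<open>f\<close>. Eliminating \<open>f\<close> between
  \<open>X\<close> (up to sign) and a covector \<open>Y\<close> that vanishes on \<open>A\<close>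
  but not at \<open>e\<close> keeps the value of \<open>Y\<close> at \<open>e\<close>, which
  contradicts the first hypothesis.\<close>

lemma vanishing_closure_exchange:
  assumes "e \<in> vanishing_closure L (insert f A)" "e \<notin> vanishing_closure L A"
  shows "f \<in> vanishing_closure L (insert e A)"
proof (rule ccontr)
  assume "f \<notin> vanishing_closure L (insert e A)"
  then obtain X where X: "X \<in> L" "X e = 0" "\<forall>a\<in>A. X a = 0" "X f \<noteq> 0"
    by (auto simp: vanishing_closure_def)
  obtain Y where Y: "Y \<in> L" "\<forall>a\<in>A. Y a = 0" "Y e \<noteq> 0"
    using assms(2) by (auto simp: vanishing_closure_def)
  have "Y f \<noteq> 0" using assms(1) Y by (auto simp: vanishing_closure_def)
  then obtain X' where X': "X' \<in> L" "X' f = - Y f" "\<And>e. X e = 0 \<Longrightarrow> X' e = 0"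
    using opposite_sign_covector[OF X(1,4) Y(1)] by blast
  with \<open>Y f \<noteq> 0\<close> obtain Z where Z: "Z \<in> L" "Z f = 0"
    "\<And>g. \<not> (X' g = - Y g \<and> X' g \<noteq> 0) \<Longrightarrow> Z g = comp_sv X' Y g"
    using elimination_opposite[of X' Y f] Y by auto
  have "\<forall>a\<in>insert f A. Z a = 0" using Z X' X Y by (auto simp: comp_sv_def)
  moreover have "Z e \<noteq> 0" using Z X' X Y by (auto simp: comp_sv_def)
  ultimately show False using assms(1) Z(1) by (auto simp: vanishing_closure_def)
qed

text \<open>If some \<open>a\<close> in \<open>I\<close> became dependent, exchange would put
  \<open>e\<close> into the closure of \<open>I\<close>.\<close>

lemma independent_in_insert:
  assumes "independent_in L I" "e \<notin> vanishing_closure L I"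
  shows "independent_in L (insert e I)"
  unfolding independent_in_def
proof (intro ballI notI)
  fix a assume a: "a \<in> insert e I" "a \<in> vanishing_closure L (insert e I - {a})"
  have e: "e \<notin> I" using assms(2) by (auto intro: vanishing_closure_extensive)
  show False
  proof (cases "a = e")
    case True
    thus ?thesis using a e assms(2) by simp
  next
    case False
    hence aI: "a \<in> I" and "insert e I - {a} = insert e (I - {a})"
      using a by blast+
    hence "a \<in> vanishing_closure L (insert e (I - {a}))" using a(2) by simp
    moreover have "a \<notin> vanishing_closure L (I - {a})"
      using assms(1) aI by (simp add: independent_in_def)
    ultimately have "e \<in> vanishing_closure L (insert a (I - {a}))"
      by (rule vanishing_closure_exchange)
    thus ?thesis using aI assms(2) by (metis insert_Diff)
  qed
qed

text \<open>Steinitz exchange: elements of \<open>I - J\<close> are replaced one at a time by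
  elements of \<open>J\<close>, with independence and cardinality preserved.\<close>

lemma independent_in_card_le:
  assumes "finite J" "finite I" "independent_in L I" "I \<subseteq> vanishing_closure L J"
  shows "card I \<le> card J"
  using assms(2-)
proof (induction "card (I - J)" arbitrary: I rule: less_induct)
  case less
  show ?case
  proof (cases "I \<subseteq> J")
    case True
    thus ?thesis using assms(1) by (simp add: card_mono)
  next
    case False
    then obtain e where e: "e \<in> I" "e \<notin> J" by blast
    \<comment> \<open>Otherwise the closure of \<open>J\<close>, which contains \<open>e\<close>,
      would lie in the closure of \<open>I - {e}\<close>.\<close>
    have "\<not> J \<subseteq> vanishing_closure L (I - {e})"
      using e less.prems vanishing_closure_least[of J L "I - {e}"]
      by (auto simp: independent_in_def)
    then obtain f where f: "f \<in> J" "f \<notin> vanishing_closure L (I - {e})" by blast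
    define I' where "I' = insert f (I - {e})"
    have fI: "f \<notin> I - {e}" using f(2) by (meson vanishing_closure_extensive)
    have "independent_in L I'" unfolding I'_def
      using independent_in_insert[OF _ f(2)] independent_in_subset[OF less.prems(2), of "I - {e}"] by blast
    moreover have "I' \<subseteq> vanishing_closure L J"
      using less.prems(3) f(1) by (auto simp: I'_def intro: vanishing_closure_extensive)
    moreover have "card (I' - J) < card (I - J)"
      using e f less.prems by (intro psubset_card_mono) (auto simp: I'_def)
    moreover have "finite I'" using less.prems by (simp add: I'_def)
    ultimately have "card I' \<le> card J" using less.hyps by blast
    moreover have "card I' = card I"
      using fI e less.prems(1) card_Suc_Diff1[of I e] by (simp add: I'_def)
    ultimately show ?thesis by simp
  qed
qed

section \<open>Bases and the rank of a set\<close>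

lemma rank_in_eqI:
  assumes "finite A" "B \<subseteq> A" "independent_in L B" "A \<subseteq> vanishing_closure L B"
  shows "rank_in L A = card B"
  unfolding rank_in_def
proof (rule Max_eqI)
  show "finite (card ` {I. I \<subseteq> A \<and> independent_in L I})" using assms(1) by simp
  show "card B \<in> card ` {I. I \<subseteq> A \<and> independent_in L I}" using assms by blast
  fix n assume "n \<in> card ` {I. I \<subseteq> A \<and> independent_in L I}"
  then obtain I where "I \<subseteq> A" "independent_in L I" "n = card I" by blast
  thus "n \<le> card B"
    using independent_in_card_le[of B I] assms finite_subset[of _ A] by (metis subset_trans)
qed

lemma ex_basis:
  assumes "finite A"
  obtains B where "B \<subseteq> A" "independent_in L B" "A \<subseteq> vanishing_closure L B"
proof -
  define P where "P = {I. I \<subseteq> A \<and> independent_in L I}"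
  have "finite P" "P \<noteq> {}" using assms by (auto simp: P_def independent_in_def)
  then obtain B where B: "B \<in> P" and max: "\<And>I. I \<in> P \<Longrightarrow> B \<subseteq> I \<Longrightarrow> B = I"
    using finite_has_maximal[of P] by blast
  have "a \<in> vanishing_closure L B" if "a \<in> A" for a
  proof (rule ccontr)
    assume a: "a \<notin> vanishing_closure L B"
    hence "insert a B \<in> P" using B that independent_in_insert by (auto simp: P_def)
    with max[of "insert a B"] a vanishing_closure_extensive[of a B L] show False by blast
  qed
  with B that show thesis by (auto simp: P_def)
qed

lemma rank_in_empty: "rank_in L {} = 0"
  using rank_in_eqI[of "{}" "{}"] by (simp add: independent_in_def)

text \<open>Here and in the next lemma a basis of \<open>A\<close> is kept or enlarged by
  \<open>e\<close>. So the sign of the rank flips exactly when \<open>e\<close> is outside the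
  closure, which drives the later cancellation.\<close>

lemma rank_in_insert_closure:
  assumes "finite A" "e \<in> vanishing_closure L A"
  shows "rank_in L (insert e A) = rank_in L A"
proof -
  obtain B where B: "B \<subseteq> A" "independent_in L B" "A \<subseteq> vanishing_closure L B"
    using ex_basis assms(1) by blast
  hence "insert e A \<subseteq> vanishing_closure L B"
    using vanishing_closure_least[OF B(3)] assms(2) by (meson insert_subset subsetD)
  hence "rank_in L (insert e A) = card B"
    using B assms(1) by (intro rank_in_eqI) auto
  moreover have "rank_in L A = card B" using B assms(1) by (intro rank_in_eqI) auto
  ultimately show ?thesis by simp
qed

lemma rank_in_insert_outside:
  assumes "finite A" "e \<notin> vanishing_closure L A"
  shows "rank_in L (insert e A) = Suc (rank_in L A)"
proof -
  obtain B where B: "B \<subseteq> A" "independent_in L B" "A \<subseteq> vanishing_closure L B"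
    using ex_basis assms(1) by blast
  have e: "e \<notin> vanishing_closure L B"
    using vanishing_closure_mono[OF B(1)] assms(2) by blast
  have "insert e A \<subseteq> vanishing_closure L (insert e B)"
    using B(3) vanishing_closure_mono[of B "insert e B" L] vanishing_closure_extensive[of e "insert e B" L]
    by blast
  hence "rank_in L (insert e A) = card (insert e B)"
    using independent_in_insert[OF B(2) e] B(1) assms(1) by (intro rank_in_eqI) auto
  moreover have "e \<notin> B" "finite B"
    using e vanishing_closure_extensive[of e B L] finite_subset[OF B(1) assms(1)] by blast+
  ultimately show ?thesis using rank_in_eqI[of A B] B assms(1) by simp
qed

end

section \<open>Restrictions\<close>

lemma restrict_sv_insert: "restrict_sv X (insert e D) = (restrict_sv X D)(e := X e)"
  by (auto simp: restrict_sv_def)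

lemma restrict_sv_restrict_sv: "D \<subseteq> D' \<Longrightarrow> restrict_sv (restrict_sv X D') D = restrict_sv X D"
  by (auto simp: restrict_sv_def fun_eq_iff)

lemma restrict_sv_comp: "restrict_sv (comp_sv X Y) D = comp_sv (restrict_sv X D) (restrict_sv Y D)"
  by (auto simp: restrict_sv_def comp_sv_def)

lemma restrict_sv_neg: "restrict_sv (neg_sv X) D = neg_sv (restrict_sv X D)"
  by (auto simp: restrict_sv_def neg_sv_def)

abbreviation restrict_om :: "('e \<Rightarrow> int) set \<Rightarrow> 'e set \<Rightarrow> ('e \<Rightarrow> int) set" where
  "restrict_om L D \<equiv> (\<lambda>X. restrict_sv X D) ` L"

lemma restrict_sv_eqD: "restrict_sv X D = G \<Longrightarrow> e \<in> D \<Longrightarrow> X e = G e"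
  by (auto simp: restrict_sv_def)

lemma restrict_sv_eqI: "(\<And>e. e \<in> D \<Longrightarrow> X e = Y e) \<Longrightarrow> restrict_sv X D = restrict_sv Y D"
  by (auto simp: restrict_sv_def)

text \<open>The flats of a restriction are the traces on \<open>D\<close> of zero sets of members of
  \<open>L\<close>. Ranks of localizations can thus all be computed inside \<open>L\<close>.\<close>

lemma om_indep_restrict_om:
  "om_indep D (restrict_om L D) A \<longleftrightarrow> A \<subseteq> D \<and> independent_in L A"
proof -
  have "a \<in> om_closure D (restrict_om L D) (A - {a}) \<longleftrightarrow> a \<in> vanishing_closure L (A - {a})"
    if "A \<subseteq> D" "a \<in> A" for a
  proof -
    have "a \<in> om_closure D (restrict_om L D) (A - {a}) \<longleftrightarrow>
      (\<forall>X\<in>L. A - {a} \<subseteq> zero_set D (restrict_sv X D) \<longrightarrow> a \<in> zero_set D (restrict_sv X D))"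
      unfolding om_closure_def om_flats_def by blast
    also have "\<dots> \<longleftrightarrow> a \<in> vanishing_closure L (A - {a})"
      using that by (auto simp: vanishing_closure_def zero_set_def restrict_sv_def subset_iff)
    finally show ?thesis .
  qed
  thus ?thesis unfolding om_indep_def independent_in_def by blast
qed

lemma om_rank_restrict_om: "om_rank D (restrict_om L D) = rank_in L D"
  by (simp add: om_rank_def rank_in_def om_indep_restrict_om)

context oriented_matroid
begin

lemma restrict_om_ground: "restrict_om L E = L"
proof -
  have "restrict_sv X E = X" if "X \<in> L" for X
    using covector_outside[OF that] by (auto simp: restrict_sv_def)
  thus ?thesis by (metis (no_types, lifting) image_cong image_ident)
qed

lemma oriented_matroid_restrict_om:
  assumes "D \<subseteq> E"
  shows "oriented_matroid D (restrict_om L D)"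
proof
  show "finite D" using assms finite_ground finite_subset by blast
  show "restrict_om L D \<subseteq> sign_vectors D"
    using covector_values by (fastforce simp: sign_vectors_def restrict_sv_def)
  show "(\<lambda>_. 0) \<in> restrict_om L D"
    by (rule image_eqI[OF _ zero_covector]) (auto simp: restrict_sv_def)
  fix X assume "X \<in> restrict_om L D"
  then obtain X' where X: "X = restrict_sv X' D" "X' \<in> L" by blast
  thus "neg_sv X \<in> restrict_om L D" using neg_closed[of X'] by (metis image_eqI restrict_sv_neg)
  fix Y assume "Y \<in> restrict_om L D"
  then obtain Y' where Y: "Y = restrict_sv Y' D" "Y' \<in> L" by blast
  with X show "comp_sv X Y \<in> restrict_om L D"
    using comp_closed[of X' Y'] by (metis image_eqI restrict_sv_comp)
  fix e assume "e \<in> separator X Y"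
  hence e: "X' e = - Y' e" "X' e \<noteq> 0" "e \<in> D"
    using X Y by (auto simp: separator_def restrict_sv_def split: if_splits)
  then obtain Z where Z: "Z \<in> L" "Z e = 0"
    "\<And>f. \<not> (X' f = - Y' f \<and> X' f \<noteq> 0) \<Longrightarrow> Z f = comp_sv X' Y' f"
    using elimination_opposite[OF X(2) Y(2)] by blast
  have "restrict_sv Z D e = 0" using Z by (simp add: restrict_sv_def)
  moreover have "restrict_sv Z D f = comp_sv X Y f" if "f \<in> D - separator X Y" for f
  proof -
    have "\<not> (X' f = - Y' f \<and> X' f \<noteq> 0)"
      using that X(1) Y(1) by (auto simp: separator_def restrict_sv_def)
    from Z(3)[OF this] that X(1) Y(1) show ?thesis by (simp add: restrict_sv_def comp_sv_def)
  qed
  ultimately show "\<exists>Z\<in>restrict_om L D. Z e = 0 \<and> (\<forall>f\<in>D - separator X Y. Z f = comp_sv X Y f)"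
    using Z(1) by blast
qed

section \<open>Signed sums over covectors\<close>

text \<open>\<open>S\<close> collects the signs at \<open>e\<close> of the covectors that agree with
  \<open>F\<close> on \<open>D\<close>. Outside the closure, a zero can be perturbed to both signs,
  and two opposite signs can be eliminated to a zero, so \<open>S\<close> is one nonzero sign or
  everything.\<close>

lemma extension_signs:
  assumes "e \<notin> D" "F \<in> L"
  defines "S \<equiv> {X e | X. X \<in> L \<and> restrict_sv X D = restrict_sv F D}"
  shows "if e \<in> vanishing_closure L {d \<in> D. F d = 0} then S = {0} else S \<in> {{1}, {-1}, {-1, 0, 1}}"
proof (cases "e \<in> vanishing_closure L {d \<in> D. F d = 0}")
  case True
  have "X e = 0" if "X \<in> L" "restrict_sv X D = restrict_sv F D" for X
  proof -
    have "X d = F d" if "d \<in> D" for d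
      using restrict_sv_eqD[OF \<open>restrict_sv X D = _\<close> that] that by (simp add: restrict_sv_def)
    with True that(1) show ?thesis by (simp add: vanishing_closure_def)
  qed
  with assms(2) True show ?thesis by (force simp: S_def)
next
  case False
  then obtain Y where Y: "Y \<in> L" "\<And>d. d \<in> D \<Longrightarrow> F d = 0 \<Longrightarrow> Y d = 0" "Y e \<noteq> 0"
    by (auto simp: vanishing_closure_def)
  have SI: "X e \<in> S" if "X \<in> L" "\<And>d. d \<in> D \<Longrightarrow> X d = F d" for X
    using that restrict_sv_eqI[of D X F] by (auto simp: S_def)
  have SE: "\<exists>X\<in>L. X e = s \<and> (\<forall>d\<in>D. X d = F d)" if "s \<in> S" for s
  proof -
    obtain X where X: "s = X e" "X \<in> L" "restrict_sv X D = restrict_sv F D"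
      using \<open>s \<in> S\<close> by (auto simp: S_def)
    have "X d = F d" if "d \<in> D" for d
      using restrict_sv_eqD[OF X(3) that] that by (simp add: restrict_sv_def)
    with X show ?thesis by blast
  qed
  have sub: "S \<subseteq> {-1, 0, 1}" using covector_values by (auto simp: S_def)
  have ne: "F e \<in> S" using SI[OF assms(2)] by blast
  have zero: "1 \<in> S \<and> -1 \<in> S" if "0 \<in> S"
  proof -
    obtain X where X: "X \<in> L" "X e = 0" "\<forall>d\<in>D. X d = F d" using SE[OF \<open>0 \<in> S\<close>] by blast
    \<comment> \<open>Composition with \<open>W\<close> only fills zeros of \<open>X\<close>, and on
      \<open>D\<close> these are zeros of \<open>W\<close> as well, so the values on
      \<open>D\<close> survive. It is applied to \<open>Y\<close> and its negative.\<close>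
    have comp: "comp_sv X W e \<in> S" if "W \<in> L" "\<And>d. d \<in> D \<Longrightarrow> F d = 0 \<Longrightarrow> W d = 0" for W
      by (rule SI[OF comp_closed[OF X(1) that(1)]]) (use X(3) that(2) in \<open>auto simp: comp_sv_def\<close>)
    have "comp_sv X Y e \<in> S" "comp_sv X (neg_sv Y) e \<in> S"
      using comp[OF Y(1,2)] comp[OF neg_closed[OF Y(1)]] Y(2) by (auto simp: neg_sv_def)
    thus ?thesis using X(2) Y(3) covector_values[OF Y(1), of e] by (auto simp: comp_sv_def neg_sv_def)
  qed
  have "0 \<in> S" if one: "1 \<in> S" and minus: "-1 \<in> S"
  proof -
    obtain X where X: "X \<in> L" "X e = 1" "\<forall>d\<in>D. X d = F d" using SE[OF one] by blast
    obtain X' where X': "X' \<in> L" "X' e = -1" "\<forall>d\<in>D. X' d = F d" using SE[OF minus] by blast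
    \<comment> \<open>On \<open>D\<close> both covectors equal \<open>F\<close>, so nothing is
      separated there and \<open>Z\<close> equals \<open>F\<close> too.\<close>
    obtain Z where Z: "Z \<in> L" "Z e = 0"
      "\<And>f. \<not> (X f = - X' f \<and> X f \<noteq> 0) \<Longrightarrow> Z f = comp_sv X X' f"
      using elimination_opposite[OF X(1) X'(1), of e] X(2) X'(2) by auto
    have "Z d = F d" if "d \<in> D" for d using that X(3) X'(3) Z(3)[of d] by (auto simp: comp_sv_def)
    thus ?thesis using SI[OF Z(1)] Z(2) by simp
  qed
  with sub ne zero have "S \<in> {{1}, {-1}, {-1, 0, 1}}"
    by (cases "0 \<in> S"; cases "1 \<in> S"; cases "-1 \<in> S") auto
  with False show ?thesis by simp
qed

text \<open>With \<open>r\<close> the rank of the zeros of \<open>G\<close>, a forced zero at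
  \<open>e\<close> leaves \<open>r\<close> unchanged, a forced nonzero sign leaves the zeros
  unchanged, and three free signs contribute
  \<open>2 * (-1)^r + (-1)^(r+1) = (-1)^r\<close>.\<close>

lemma sum_extensions_rank_sign:
  assumes "finite D" "e \<notin> D" "G \<in> restrict_om L D"
  shows "(\<Sum>H | H \<in> restrict_om L (insert e D) \<and> restrict_sv H D = G.
      (- 1) ^ rank_in L {d \<in> insert e D. H d = 0}) = ((- 1) ^ rank_in L {d \<in> D. G d = 0} :: 'a :: comm_ring_1)"
proof -
  obtain F where F: "F \<in> L" "G = restrict_sv F D" using assms(3) by blast
  define S where "S = {X e | X. X \<in> L \<and> restrict_sv X D = restrict_sv F D}"
  define Z where "Z = {d \<in> D. G d = 0}"
  have Z: "finite Z" "Z = {d \<in> D. F d = 0}" using assms(1) F(2) by (auto simp: Z_def restrict_sv_def)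
  have fibre: "{H. H \<in> restrict_om L (insert e D) \<and> restrict_sv H D = G} = (\<lambda>s. G(e := s)) ` S"
  proof -
    have "restrict_sv (restrict_sv X (insert e D)) D = restrict_sv X D" for X
      by (simp add: restrict_sv_restrict_sv subset_insertI)
    thus ?thesis unfolding S_def F(2) using restrict_sv_insert[of _ e D] by (auto simp: image_iff) metis+
  qed
  have zero: "{d \<in> insert e D. (G(e := s)) d = 0} = (if s = 0 then insert e Z else Z)" for s
    using assms(2) by (auto simp: Z_def)
  have "inj_on (\<lambda>s. G(e := s)) S" by (rule inj_onI) (metis fun_upd_same)
  hence "(\<Sum>H | H \<in> restrict_om L (insert e D) \<and> restrict_sv H D = G.
      (- 1) ^ rank_in L {d \<in> insert e D. H d = 0}) =
      (\<Sum>s\<in>S. (- 1) ^ rank_in L (if s = 0 then insert e Z else Z) :: 'a)"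
    unfolding fibre by (simp only: sum.reindex o_def zero)
  also have "\<dots> = (- 1) ^ rank_in L Z"
    using extension_signs[OF assms(2) F(1), folded S_def Z(2)]
      rank_in_insert_closure[OF Z(1), of e] rank_in_insert_outside[OF Z(1), of e]
    by (auto split: if_splits)
  finally show ?thesis by (simp only: Z_def)
qed

text \<open>Induction on the elements outside \<open>P\<close>: grouping the covectors on the larger
  set by their restrictions reduces each fibre to a one-element extension.\<close>

lemma sum_agreeing_restrictions_rank_sign:
  assumes "finite D'" "finite P" "P \<inter> D' = {}" "B \<in> L" "\<And>e. e \<in> P \<Longrightarrow> B e \<noteq> 0"
  shows "(\<Sum>G | G \<in> restrict_om L (P \<union> D') \<and> (\<forall>e\<in>P. G e = B e).
      (- 1) ^ rank_in L {d \<in> P \<union> D'. G d = 0}) = (1 :: 'a :: comm_ring_1)"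
  using assms(1,3)
proof (induction D' rule: finite_induct)
  case empty
  \<comment> \<open>On \<open>P\<close> alone only the restriction of \<open>B\<close> is left; it
    has no zeros, hence rank 0 and sign 1.\<close>
  have "{G. G \<in> restrict_om L P \<and> (\<forall>e\<in>P. G e = B e)} = {restrict_sv B P}"
    using assms(4) by (auto simp: restrict_sv_def)
  moreover have none: "{d \<in> P. restrict_sv B P d = 0} = {}" using assms(5) by (auto simp: restrict_sv_def)
  ultimately have "(\<Sum>G | G \<in> restrict_om L P \<and> (\<forall>e\<in>P. G e = B e). (- 1) ^ rank_in L {d \<in> P. G d = 0}) =
    ((- 1) ^ rank_in L {d \<in> P. restrict_sv B P d = 0} :: 'a)" by simp
  thus ?case by (simp only: none rank_in_empty Un_empty_right power_0)
next
  case (insert e D')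
  define D where "D = P \<union> D'"
  have D: "finite D" "e \<notin> D" "P \<union> insert e D' = insert e D"
    using insert assms(2) by (auto simp: D_def)
  define R where "R = (\<lambda>D. {G. G \<in> restrict_om L D \<and> (\<forall>e\<in>P. G e = B e)})"
  have fin: "finite (R D)" for D using finite_covectors by (simp add: R_def)
  have res: "restrict_sv H D \<in> R D" if "H \<in> R (insert e D)" for H
  proof -
    obtain X where X: "X \<in> L" "H = restrict_sv X (insert e D)"
      using \<open>H \<in> R (insert e D)\<close> by (auto simp: R_def)
    have agree: "\<forall>e\<in>P. H e = B e" using that by (simp add: R_def)
    have "restrict_sv H D = restrict_sv X D"
      using X(2) by (simp add: restrict_sv_restrict_sv subset_insertI)
    moreover have "\<forall>e\<in>P. restrict_sv H D e = B e"
      using agree by (simp add: restrict_sv_def D_def)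
    ultimately show ?thesis using X(1) by (simp add: R_def)
  qed
  have fibre: "{H. H \<in> R (insert e D) \<and> restrict_sv H D = G} =
    {H. H \<in> restrict_om L (insert e D) \<and> restrict_sv H D = G}" if "G \<in> R D" for G
  proof -
    have "\<forall>e\<in>P. H e = B e" if "restrict_sv H D = G" for H
      using \<open>G \<in> R D\<close> restrict_sv_eqD[OF that] by (simp add: R_def D_def)
    thus ?thesis by (auto simp: R_def)
  qed
  have "(\<Sum>H\<in>R (insert e D). (- 1) ^ rank_in L {d \<in> insert e D. H d = 0}) =
    (\<Sum>G\<in>R D. \<Sum>H | H \<in> R (insert e D) \<and> restrict_sv H D = G.
      (- 1) ^ rank_in L {d \<in> insert e D. H d = 0} :: 'a)"
    by (rule sum.group[OF fin fin, symmetric]) (use res in blast)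
  also have "\<dots> = (\<Sum>G\<in>R D. (- 1) ^ rank_in L {d \<in> D. G d = 0})"
  proof (rule sum.cong[OF refl])
    fix G assume G: "G \<in> R D"
    hence "G \<in> restrict_om L D" by (simp add: R_def)
    thus "(\<Sum>H | H \<in> R (insert e D) \<and> restrict_sv H D = G.
        (- 1) ^ rank_in L {d \<in> insert e D. H d = 0}) = ((- 1) ^ rank_in L {d \<in> D. G d = 0} :: 'a)"
      unfolding fibre[OF G] by (rule sum_extensions_rank_sign[OF D(1,2)])
  qed
  also have "\<dots> = 1" using insert by (simp add: R_def D_def)
  finally show ?case unfolding D(3) R_def .
qed

lemma sum_agreeing_covectors_rank_sign:
  assumes "P \<subseteq> E" "B \<in> L" "\<And>e. e \<in> P \<Longrightarrow> B e \<noteq> 0"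
  shows "(\<Sum>F | F \<in> L \<and> (\<forall>e\<in>P. F e = B e). (- 1) ^ rank_in L (zero_set E F)) = (1 :: 'a :: comm_ring_1)"
proof -
  have "P \<union> (E - P) = E" using assms(1) by blast
  thus ?thesis
    using sum_agreeing_restrictions_rank_sign[of "E - P" P B] assms finite_ground finite_subset[OF assms(1)]
    by (simp add: restrict_om_ground zero_set_def)
qed

text \<open>The value of the assembled weighting at a tope \<open>B\<close>, to be used with
  \<open>q\<close> equal to \<open>qvar\<close>.\<close>

lemma sum_rank_sign_disagreement:
  fixes q :: "'a :: comm_ring_1"
  assumes "B \<in> L" "\<And>e. e \<in> E \<Longrightarrow> B e \<noteq> 0"
  shows "(\<Sum>F\<in>L. (- 1) ^ rank_in L (zero_set E F) * q ^ card {e \<in> E. F e \<noteq> B e}) = 1"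
proof -
  have expand: "q ^ card {e \<in> E. F e \<noteq> B e} =
    (\<Sum>P\<in>Pow E. of_bool (\<forall>e\<in>P. F e = B e) * ((1 - q) ^ card P * q ^ card (E - P)))" for F
  proof -
    have "q ^ card {e \<in> E. F e \<noteq> B e} = (\<Prod>e\<in>{e \<in> E. F e \<noteq> B e}. q)" by simp
    \<comment> \<open>The factor is 1 where \<open>F\<close> and \<open>B\<close> agree and
      \<open>q\<close> elsewhere. Multiplying out gives a sum over sets \<open>P\<close> on which
      agreement is imposed.\<close>
    also have "\<dots> = (\<Prod>e\<in>E. of_bool (F e = B e) * (1 - q) + q)"
      using finite_ground by (intro prod.mono_neutral_cong_left) auto
    also have "\<dots> = (\<Sum>P\<in>Pow E. (\<Prod>e\<in>P. of_bool (F e = B e) * (1 - q)) * (\<Prod>e\<in>E - P. q))"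
      by (rule prod_add[OF finite_ground])
    also have "\<dots> = (\<Sum>P\<in>Pow E. of_bool (\<forall>e\<in>P. F e = B e) * ((1 - q) ^ card P * q ^ card (E - P)))"
    proof (rule sum.cong[OF refl])
      fix P assume "P \<in> Pow E"
      hence "finite P" using finite_ground finite_subset by blast
      hence "(\<Prod>e\<in>P. of_bool (F e = B e)) = (of_bool (\<forall>e\<in>P. F e = B e) :: 'a)"
        by (induction P rule: finite_induct) auto
      thus "(\<Prod>e\<in>P. of_bool (F e = B e) * (1 - q)) * (\<Prod>e\<in>E - P. q) =
        of_bool (\<forall>e\<in>P. F e = B e) * ((1 - q) ^ card P * q ^ card (E - P))"
        by (simp add: prod.distrib mult.assoc)
    qed
    finally show ?thesis .
  qed
  have "(\<Sum>F\<in>L. (- 1) ^ rank_in L (zero_set E F) * q ^ card {e \<in> E. F e \<noteq> B e}) =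
    (\<Sum>P\<in>Pow E. \<Sum>F\<in>L. (- 1) ^ rank_in L (zero_set E F) *
      (of_bool (\<forall>e\<in>P. F e = B e) * ((1 - q) ^ card P * q ^ card (E - P))))"
    unfolding expand sum_distrib_left by (rule sum.swap)
  also have "\<dots> = (\<Sum>P\<in>Pow E. (1 - q) ^ card P * q ^ card (E - P) *
      (\<Sum>F | F \<in> L \<and> (\<forall>e\<in>P. F e = B e). (- 1) ^ rank_in L (zero_set E F)))"
    unfolding sum_distrib_left
    by (intro sum.cong[OF refl] sum.mono_neutral_cong_right) (auto simp: finite_covectors)
  also have "\<dots> = (\<Sum>P\<in>Pow E. (\<Prod>e\<in>P. 1 - q) * (\<Prod>e\<in>E - P. q))"
    using assms by (intro sum.cong[OF refl]) (simp add: sum_agreeing_covectors_rank_sign subset_iff)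
  \<comment> \<open>Every inner signed sum was 1, so the expansion folds back into a product of
    factors 1.\<close>
  also have "\<dots> = (\<Prod>e\<in>E. (1 - q) + q)"
    by (rule prod_add[OF finite_ground, symmetric])
  finally show ?thesis by simp
qed

end

section \<open>Weightings of finite connected graphs\<close>

text \<open>The predicate under the definite description in \<open>inverse_on\<close>, named so that
  existence and uniqueness can be proved separately.\<close>

definition is_inverse_on :: "'v set \<Rightarrow> ('v \<Rightarrow> 'v \<Rightarrow> 'a :: field) \<Rightarrow> ('v \<Rightarrow> 'v \<Rightarrow> 'a) \<Rightarrow> bool" where
  "is_inverse_on V K N \<longleftrightarrow>
     (\<forall>u v. u \<notin> V \<or> v \<notin> V \<longrightarrow> N u v = 0) \<and>
     (\<forall>u\<in>V. \<forall>v\<in>V. (\<Sum>w\<in>V. K u w * N w v) = (if u = v then 1 else 0)) \<and>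
     (\<forall>u\<in>V. \<forall>v\<in>V. (\<Sum>w\<in>V. N u w * K w v) = (if u = v then 1 else 0))"

text \<open>Associativity: \<open>N = N (K N') = (N K) N' = N'\<close>.\<close>

lemma is_inverse_on_unique:
  assumes "finite V" "is_inverse_on V K N" "is_inverse_on V K N'"
  shows "N = N'"
proof (intro ext)
  fix u v
  show "N u v = N' u v"
  proof (cases "u \<in> V \<and> v \<in> V")
    case True
    have "N u v = (\<Sum>w\<in>V. N u w * (\<Sum>x\<in>V. K w x * N' x v))"
    proof -
      have "(\<Sum>w\<in>V. N u w * (\<Sum>x\<in>V. K w x * N' x v)) = (\<Sum>w\<in>V. if w = v then N u w else 0)"
        using True assms(3) by (intro sum.cong) (auto simp: is_inverse_on_def)
      thus ?thesis using True assms(1) by simp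
    qed
    also have "\<dots> = (\<Sum>x\<in>V. (\<Sum>w\<in>V. N u w * K w x) * N' x v)"
      unfolding sum_distrib_left sum_distrib_right by (subst sum.swap) (simp add: mult.assoc)
    also have "\<dots> = (\<Sum>x\<in>V. if u = x then N' x v else 0)"
      using True assms(2) by (intro sum.cong) (auto simp: is_inverse_on_def)
    also have "\<dots> = N' u v" using True assms(1) by simp
    finally show ?thesis .
  qed (use assms in \<open>auto simp: is_inverse_on_def\<close>)
qed

lemma inverse_on_eqI:
  assumes "finite V" "is_inverse_on V K N"
  shows "inverse_on V K = N"
  unfolding inverse_on_def is_inverse_on_def[symmetric]
  using assms(2) is_inverse_on_unique[OF assms(1) _ assms(2)] by (rule the_equality)

text \<open>The determinant is a polynomial with value 1 at 0, hence nonzero, hence a unit in the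
  fraction field.\<close>

lemma is_inverse_on_if_identity_at_0:
  fixes P :: "'v \<Rightarrow> 'v \<Rightarrow> rat poly"
  assumes "finite V" "\<And>u v. u \<in> V \<Longrightarrow> v \<in> V \<Longrightarrow> poly (P u v) 0 = (if u = v then 1 else 0)"
  shows "\<exists>N. is_inverse_on V (\<lambda>u v. to_fract (P u v)) N"
proof -
  define n where "n = card V"
  \<comment> \<open>The enumeration \<open>f\<close> with inverse \<open>g\<close> translates
    between matrices indexed by \<open>V\<close> and \<open>n\<close> by \<open>n\<close>
    matrices.\<close>
  obtain f where f: "bij_betw f {0..<n} V"
    using ex_bij_betw_nat_finite[OF assms(1)] by (auto simp: n_def)
  define g where "g = inv_into {0..<n} f"
  have fV: "f i \<in> V" if "i < n" for i using f that by (auto simp: bij_betw_def)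
  have gf: "g (f i) = i" if "i < n" for i
    using f that unfolding g_def bij_betw_def by (intro inv_into_f_f) auto
  have gV: "g u < n" and fg: "f (g u) = u" if "u \<in> V" for u
    using f that inv_into_into[of u f "{0..<n}"] f_inv_into_f[of u f "{0..<n}"]
    by (auto simp: g_def bij_betw_def)
  define M where "M = mat n n (\<lambda>(i, j). P (f i) (f j))"
  interpret ev: comm_ring_hom "\<lambda>p :: rat poly. poly p 0" by unfold_locales auto
  interpret emb: comm_ring_hom "to_fract :: rat poly \<Rightarrow> _" by unfold_locales auto
  have "f i = f j \<longleftrightarrow> i = j" if "i < n" "j < n" for i j
    using gf that by metis
  hence "map_mat (\<lambda>p. poly p 0) M = 1\<^sub>m n"
    by (intro eq_matI) (auto simp: M_def assms(2) fV)
  \<comment> \<open>Evaluation at 0 is a ring homomorphism and so commutes with the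
    determinant.\<close>
  hence "poly (det M) 0 = 1" by (metis det_one ev.hom_det)
  hence "det M \<noteq> 0" by auto
  define A where "A = map_mat to_fract M"
  have "det A = to_fract (det M)" unfolding A_def by (rule emb.hom_det)
  hence "det A \<noteq> 0" using \<open>det M \<noteq> 0\<close> by (metis to_fract_eq_0_iff)
  have A: "A \<in> carrier_mat n n" by (simp add: A_def M_def)
  have "A \<in> Units (ring_mat TYPE(rat poly fract) n ())"
    by (rule det_non_zero_imp_unit) fact+
  then obtain B where B: "B \<in> carrier_mat n n" "B * A = 1\<^sub>m n" "A * B = 1\<^sub>m n"
    by (auto simp: Units_def ring_mat_simps)
  define N where "N = (\<lambda>u v. if u \<in> V \<and> v \<in> V then B $$ (g u, g v) else 0)"
  have entries: "(\<Sum>w\<in>V. h w) = (\<Sum>k = 0..<n. h (f k))" for h :: "'v \<Rightarrow> rat poly fract"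
    by (rule sum.reindex_bij_betw[OF f, symmetric])
  have K: "to_fract (P u v) = A $$ (g u, g v)" if "u \<in> V" "v \<in> V" for u v
    using that by (simp add: A_def M_def gV fg)
  have mult: "(\<Sum>k = 0..<n. X $$ (i, k) * Y $$ (k, j)) = (X * Y) $$ (i, j)"
    if "X \<in> carrier_mat n n" "Y \<in> carrier_mat n n" "i < n" "j < n"
    for X Y :: "rat poly fract mat" and i j
    using that by (auto simp: scalar_prod_def intro!: sum.cong)
  have g_eq: "g u = g v \<longleftrightarrow> u = v" if "u \<in> V" "v \<in> V" for u v using fg that by metis
  have "is_inverse_on V (\<lambda>u v. to_fract (P u v)) N"
    unfolding is_inverse_on_def entries
  proof (intro conjI ballI)
    fix u v assume uv: "u \<in> V" "v \<in> V"
    show "(\<Sum>k = 0..<n. to_fract (P u (f k)) * N (f k) v) = (if u = v then 1 else 0)"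
      using uv mult[OF A B(1) gV gV] B(3) by (simp add: K fV gf N_def gV g_eq)
    show "(\<Sum>k = 0..<n. N u (f k) * to_fract (P (f k) v)) = (if u = v then 1 else 0)"
      using uv mult[OF B(1) A gV gV] B(2) by (simp add: K fV gf N_def gV g_eq)
  qed (simp add: N_def)
  thus ?thesis by blast
qed

text \<open>The given walk ensures that the \<open>LEAST\<close> in \<open>graph_dist\<close> is
  attained, and a walk of length 0 does not move.\<close>

lemma graph_dist_eq_0_iff:
  assumes "(u, v) \<in> snd G ^^ n"
  shows "graph_dist G u v = 0 \<longleftrightarrow> u = v"
proof -
  have "(u, v) \<in> snd G ^^ graph_dist G u v"
    unfolding graph_dist_def by (rule LeastI[of _ n]) (rule assms)
  moreover have "graph_dist G u u = 0" unfolding graph_dist_def by (rule Least_eq_0) simp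
  ultimately show ?thesis by (metis relpow_0_E)
qed

text \<open>Diagonal entries are \<open>q^0\<close> and all others are positive powers of
  \<open>q\<close>, so the matrix is the identity at \<open>q = 0\<close>.\<close>

lemma similarity_matrix_invertible:
  assumes "finite (fst G)" "\<And>u v. u \<in> fst G \<Longrightarrow> v \<in> fst G \<Longrightarrow> \<exists>n. (u, v) \<in> snd G ^^ n"
  obtains N where "is_inverse_on (fst G) (similarity_matrix G) N"
proof -
  define P where "P = (\<lambda>u v. [:0, 1 :: rat:] ^ graph_dist G u v)"
  interpret emb: comm_ring_hom "to_fract :: rat poly \<Rightarrow> _" by unfold_locales auto
  have "qvar ^ k = to_fract ([:0, 1:] ^ k)" for k
    by (simp only: emb.hom_power) (simp add: qvar_def to_fract_def)
  hence "similarity_matrix G = (\<lambda>u v. to_fract (P u v))"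
    by (simp add: similarity_matrix_def P_def)
  moreover have "poly (P u v) 0 = (if u = v then 1 else 0)" if "u \<in> fst G" "v \<in> fst G" for u v
    using assms(2)[OF that] graph_dist_eq_0_iff[of u v _ G] by (auto simp: P_def poly_power zero_power)
  ultimately show thesis using is_inverse_on_if_identity_at_0[OF assms(1), of P] that by auto
qed

section \<open>Weightings and magnitude\<close>

definition is_weighting :: "'v graph \<Rightarrow> ('v \<Rightarrow> rat poly fract) \<Rightarrow> bool" where
  "is_weighting G w \<longleftrightarrow> (\<forall>u\<in>fst G. (\<Sum>v\<in>fst G. similarity_matrix G u v * w v) = 1)"

text \<open>If \<open>K w = 1\<close>, then the row sums of the inverse, \<open>N 1 = N K w\<close>,
  are the entries of \<open>w\<close>.\<close>

lemma magnitude_eq_sum_weighting: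
  assumes "finite (fst G)" "\<And>u v. u \<in> fst G \<Longrightarrow> v \<in> fst G \<Longrightarrow> \<exists>n. (u, v) \<in> snd G ^^ n"
    and "is_weighting G w"
  shows "magnitude G = sum w (fst G)"
proof -
  obtain N where N: "is_inverse_on (fst G) (similarity_matrix G) N"
    using similarity_matrix_invertible[OF assms(1,2)] by blast
  let ?V = "fst G"
  have "(\<Sum>v\<in>?V. N u v) = w u" if "u \<in> ?V" for u
  proof -
    have "(\<Sum>v\<in>?V. N u v) = (\<Sum>v\<in>?V. N u v * (\<Sum>x\<in>?V. similarity_matrix G v x * w x))"
      using assms(3) by (simp add: is_weighting_def)
    also have "\<dots> = (\<Sum>x\<in>?V. (\<Sum>v\<in>?V. N u v * similarity_matrix G v x) * w x)"
      unfolding sum_distrib_left sum_distrib_right by (subst sum.swap) (simp add: mult.assoc)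
    also have "\<dots> = (\<Sum>x\<in>?V. if u = x then w x else 0)"
      using that N by (intro sum.cong) (auto simp: is_inverse_on_def)
    also have "\<dots> = w u" using that assms(1) by simp
    finally show ?thesis .
  qed
  thus ?thesis by (simp add: magnitude_def inverse_on_eqI[OF assms(1) N])
qed

text \<open>The row sums of the inverse matrix form a weighting.\<close>

lemma ex_weighting:
  assumes "finite (fst G)" "\<And>u v. u \<in> fst G \<Longrightarrow> v \<in> fst G \<Longrightarrow> \<exists>n. (u, v) \<in> snd G ^^ n"
  obtains w where "is_weighting G w"
proof -
  obtain N where N: "is_inverse_on (fst G) (similarity_matrix G) N"
    using similarity_matrix_invertible[OF assms] by blast
  let ?V = "fst G"
  have "(\<Sum>v\<in>?V. similarity_matrix G u v * (\<Sum>x\<in>?V. N v x)) = 1" if "u \<in> ?V" for u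
  proof -
    have "(\<Sum>v\<in>?V. similarity_matrix G u v * (\<Sum>x\<in>?V. N v x)) =
      (\<Sum>x\<in>?V. \<Sum>v\<in>?V. similarity_matrix G u v * N v x)"
      unfolding sum_distrib_left by (rule sum.swap)
    also have "\<dots> = (\<Sum>x\<in>?V. if u = x then 1 else 0)"
      using that N by (intro sum.cong) (auto simp: is_inverse_on_def)
    also have "\<dots> = 1" using that assms(1) by simp
    finally show ?thesis .
  qed
  with that[of "\<lambda>v. \<Sum>x\<in>?V. N v x"] show thesis by (simp add: is_weighting_def)
qed

section \<open>Tope graphs of simple oriented matroids\<close>

locale simple_oriented_matroid = oriented_matroid +
  assumes simple: "om_simple E L"
begin

lemma simple_independent:
  assumes "e \<in> E" "f \<in> E"
  shows "independent_in L {e, f}"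
  using simple assms om_indep_restrict_om[of E L] by (auto simp: om_simple_def restrict_om_ground)

lemma no_loop:
  assumes "e \<in> E"
  obtains X where "X \<in> L" "X e \<noteq> 0"
  \<comment> \<open>Taking both elements equal, independence says that \<open>e\<close> is outside
    the closure of the empty set.\<close>
  using simple_independent[OF assms assms] by (auto simp: independent_in_def vanishing_closure_def)

lemma no_parallel:
  assumes "e \<in> E" "f \<in> E" "e \<noteq> f"
  obtains X where "X \<in> L" "X e = 0" "X f \<noteq> 0"
proof -
  have "f \<notin> vanishing_closure L ({e, f} - {f})"
    using simple_independent[OF assms(1,2)] by (simp add: independent_in_def)
  thus thesis using that assms(3) by (auto simp: vanishing_closure_def)
qed

lemma simple_restrict_om:
  assumes "D \<subseteq> E"
  shows "simple_oriented_matroid D (restrict_om L D)"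
proof -
  interpret R: oriented_matroid D "restrict_om L D"
    by (rule oriented_matroid_restrict_om[OF assms])
  have "independent_in L {e, f}" if "e \<in> D" "f \<in> D" for e f
    using that assms simple_independent by blast
  from this this[of e e for e] have "om_simple D (restrict_om L D)"
    unfolding om_simple_def om_indep_restrict_om by auto
  thus ?thesis by unfold_locales
qed

text \<open>A zero of a tope at some \<open>e\<close> in \<open>E\<close> could be filled by
  composing with a covector nonzero at \<open>e\<close>, against maximality.\<close>

lemma topes_iff: "B \<in> topes L \<longleftrightarrow> B \<in> L \<and> (\<forall>e\<in>E. B e \<noteq> 0)"
proof (intro iffI conjI ballI)
  assume B: "B \<in> topes L"
  thus L: "B \<in> L" by (simp add: topes_def)
  fix e assume "e \<in> E"
  then obtain X where X: "X \<in> L" "X e \<noteq> 0" using no_loop by blast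
  have "comp_sv B X = B"
    using B comp_closed[OF L X(1)] by (auto simp: topes_def le_sv_def comp_sv_def)
  hence "comp_sv B X e = B e" by simp
  thus "B e \<noteq> 0" using X(2) by (auto simp: comp_sv_def split: if_splits)
next
  assume B: "B \<in> L \<and> (\<forall>e\<in>E. B e \<noteq> 0)"
  have "X = B" if X: "X \<in> L" "le_sv B X" for X
  proof
    fix e show "X e = B e"
      using B X covector_outside[of X e] covector_outside[of B e] by (cases "e \<in> E") (auto simp: le_sv_def)
  qed
  with B show "B \<in> topes L" by (simp add: topes_def)
qed

lemma finite_topes: "finite (topes L)"
  using finite_covectors by (simp add: topes_def)

lemma tope_neq_iff:
  assumes "B \<in> topes L" "C \<in> topes L"
  shows "B e \<noteq> C e \<longleftrightarrow> e \<in> E \<and> C e = - B e"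
proof (cases "e \<in> E")
  case True
  have "X e = -1 \<or> X e = 1" if "X \<in> topes L" for X
  proof -
    have "X \<in> L" "X e \<noteq> 0" using that True by (simp_all add: topes_iff)
    thus ?thesis using covector_values[of X e] by simp
  qed
  from this[OF assms(1)] this[OF assms(2)] show ?thesis using True by (elim disjE) simp_all
next
  case False
  thus ?thesis using assms covector_outside[of B e] covector_outside[of C e] by (simp add: topes_iff)
qed

lemma finite_disagreement:
  assumes "B \<in> L" "C \<in> L"
  shows "finite {e. B e \<noteq> C e}"
  using covector_outside[OF assms(1)] covector_outside[OF assms(2)]
  by (intro finite_subset[OF _ finite_ground]) force

section \<open>Paths and distances in the tope graph\<close>

lemma ex_adjacent_tope_towards:
  assumes B: "B \<in> topes L" and C: "C \<in> topes L" and "B \<noteq> C"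
  obtains B' e where "B' \<in> topes L" "{g. B g \<noteq> B' g} = {e}" "B e \<noteq> C e"
proof -
  \<comment> \<open>A tope \<open>T \<noteq> B\<close> between \<open>B\<close> and \<open>C\<close> closest to \<open>B\<close> is adjacent to \<open>B\<close>.\<close>
  define \<Delta> where "\<Delta> = (\<lambda>X. {g. B g \<noteq> X g})"
  define Q where "Q = (\<lambda>X. X \<in> topes L \<and> X \<noteq> B \<and> \<Delta> X \<subseteq> \<Delta> C)"
  have "Q C" using assms by (auto simp: Q_def)
  then obtain T where T: "Q T" and min: "\<And>X. Q X \<Longrightarrow> card (\<Delta> T) \<le> card (\<Delta> X)"
    using ex_has_least_nat[of Q C "\<lambda>X. card (\<Delta> X)"] by blast
  have TL: "T \<in> topes L" "T \<in> L" "B \<in> L" using T B by (auto simp: Q_def topes_iff)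
  have fin: "finite (\<Delta> T)" unfolding \<Delta>_def using TL by (intro finite_disagreement)
  have min': "\<Delta> X = \<Delta> T" if "X \<in> topes L" "X \<noteq> B" "\<Delta> X \<subseteq> \<Delta> T" for X
  proof (rule card_seteq[OF fin that(3)])
    show "card (\<Delta> T) \<le> card (\<Delta> X)" using that T by (intro min) (auto simp: Q_def)
  qed
  have "B \<noteq> T" using T by (auto simp: Q_def)
  then obtain e where e: "B e \<noteq> T e" by blast
  hence eE: "e \<in> E" "B e = - T e" using tope_neq_iff[OF B TL(1), of e] by simp_all
  hence Be: "B e \<noteq> 0" using B unfolding topes_iff by blast
  have "\<Delta> T = {e}"
  proof (rule ccontr)
    assume "\<Delta> T \<noteq> {e}"
    then obtain f where f: "B f \<noteq> T f" "f \<noteq> e" using e by (auto simp: \<Delta>_def)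
    hence fE: "f \<in> E" using tope_neq_iff[OF B TL(1), of f] by simp
    hence Bf: "B f \<noteq> 0" using B unfolding topes_iff by blast
    obtain Z where Z: "Z \<in> L" "Z e = 0" "\<And>g. \<not> (B g = - T g \<and> B g \<noteq> 0) \<Longrightarrow> Z g = comp_sv B T g"
      using elimination_opposite[OF TL(3,2) eE(2) Be] by blast
    have Z_out: "Z g = B g" if "g \<notin> \<Delta> T" for g
    proof -
      have "B g = T g" using that by (simp add: \<Delta>_def)
      thus ?thesis using Z(3)[of g] by (auto simp: comp_sv_def)
    qed
    have tope: "comp_sv Z X \<in> topes L" if "X \<in> topes L" for X
      using that comp_closed[OF Z(1), of X] unfolding topes_iff by (simp add: comp_sv_def)
    \<comment> \<open>If not, this tope would compete with \<open>T\<close> and so differ from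
      \<open>B\<close> on all of \<open>\<Delta> T\<close>; but it equals \<open>B\<close> at
      \<open>e\<close>.\<close>
    have "comp_sv Z B = B"
    proof (rule ccontr)
      assume ne: "comp_sv Z B \<noteq> B"
      have "\<Delta> (comp_sv Z B) \<subseteq> \<Delta> T" using Z_out by (auto simp: \<Delta>_def comp_sv_def)
      hence "\<Delta> (comp_sv Z B) = \<Delta> T" using min' tope[OF B] ne by blast
      moreover have "e \<notin> \<Delta> (comp_sv Z B)" using Z(2) by (simp add: \<Delta>_def comp_sv_def)
      ultimately show False using e by (simp add: \<Delta>_def)
    qed
    hence ZB: "Z g = 0 \<or> Z g = B g" for g by (metis comp_sv_def)
    \<comment> \<open>This tope keeps the sign of \<open>T\<close> at \<open>e\<close>, so it is
      another competitor. Minimality then leaves \<open>Z\<close> no nonzero value on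
      \<open>\<Delta> T\<close>.\<close>
    have "\<Delta> (comp_sv Z T) = \<Delta> T"
    proof (rule min')
      show "comp_sv Z T \<in> topes L" by (rule tope[OF TL(1)])
      have "comp_sv Z T e \<noteq> B e" using e Z(2) by (simp add: comp_sv_def)
      thus "comp_sv Z T \<noteq> B" by auto
      show "\<Delta> (comp_sv Z T) \<subseteq> \<Delta> T" using Z_out ZB by (auto simp: \<Delta>_def comp_sv_def)
    qed
    hence Z_in: "Z g = 0" if "g \<in> \<Delta> T" for g
    proof -
      have "g \<in> \<Delta> (comp_sv Z T)" using \<open>\<Delta> (comp_sv Z T) = \<Delta> T\<close> that by simp
      thus ?thesis using ZB[of g] by (auto simp: \<Delta>_def comp_sv_def split: if_splits)
    qed
    \<comment> \<open>\<open>Z\<close> vanishes exactly on \<open>\<Delta> T\<close>, so perturbing it by a covector separating \<open>f\<close> from \<open>e\<close> yields a tope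
      closer to \<open>B\<close> than \<open>T\<close>.\<close>
    obtain X where X: "X \<in> L" "X e = 0" "X f \<noteq> 0" using no_parallel[OF eE(1) fE] f(2) by blast
    obtain X' where X': "X' \<in> L" "X' f = - B f" "\<And>g. X g = 0 \<Longrightarrow> X' g = 0"
      using opposite_sign_covector[OF X(1,3) TL(3) Bf] by blast
    \<comment> \<open>\<open>Z\<close> secures the signs of \<open>B\<close> off
      \<open>\<Delta> T\<close>, \<open>X'\<close> flips \<open>f\<close>, and \<open>B\<close>
      fills the remaining zeros, among them \<open>e\<close>.\<close>
    define W where "W = comp_sv Z (comp_sv X' B)"
    have "W \<in> L" unfolding W_def using Z(1) X'(1) TL(3) by (intro comp_closed)
    hence "W \<in> topes L" using B by (simp add: W_def topes_iff comp_sv_def)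
    moreover have "W f \<noteq> B f" using Z_in[of f] f X'(2) Bf by (simp add: W_def comp_sv_def \<Delta>_def)
    moreover have "\<Delta> W \<subseteq> \<Delta> T"
    proof
      fix g assume "g \<in> \<Delta> W"
      show "g \<in> \<Delta> T"
      proof (rule ccontr)
        assume g: "g \<notin> \<Delta> T"
        have "W g = B g"
        proof (cases "g \<in> E")
          case True
          thus ?thesis using Z_out[OF g] B by (simp add: W_def comp_sv_def topes_iff)
        next
          case False
          thus ?thesis using \<open>W \<in> L\<close> TL(3) covector_outside[of W g] covector_outside[of B g] by simp
        qed
        with \<open>g \<in> \<Delta> W\<close> show False by (simp add: \<Delta>_def)
      qed
    qed
    ultimately have "\<Delta> W = \<Delta> T" by (intro min') auto
    have "W e = B e" using Z(2) X'(3)[OF X(2)] by (simp add: W_def comp_sv_def)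
    hence "e \<notin> \<Delta> W" by (simp add: \<Delta>_def)
    moreover have "e \<in> \<Delta> T" using e by (simp add: \<Delta>_def)
    ultimately show False using \<open>\<Delta> W = \<Delta> T\<close> by simp
  qed
  moreover have "B e \<noteq> C e" using T e by (auto simp: Q_def \<Delta>_def)
  ultimately show thesis using that TL(1) by (simp add: \<Delta>_def)
qed

text \<open>Each step to an adjacent tope towards \<open>C\<close> removes exactly one
  disagreement.\<close>

lemma tope_path:
  assumes "B \<in> topes L" "C \<in> topes L"
  shows "(B, C) \<in> snd (tope_graph L) ^^ card {e. B e \<noteq> C e}"
  using assms(1)
proof (induction "card {e. B e \<noteq> C e}" arbitrary: B)
  case 0
  hence "{e. B e \<noteq> C e} = {}" using finite_disagreement assms(2) by (simp add: topes_iff)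
  hence "B = C" by auto
  thus ?case by simp
next
  case (Suc n)
  hence "B \<noteq> C" by auto
  obtain B' e where B': "B' \<in> topes L" "{g. B g \<noteq> B' g} = {e}" "B e \<noteq> C e"
    by (rule ex_adjacent_tope_towards[OF Suc.prems assms(2) \<open>B \<noteq> C\<close>])
  have diff: "B g \<noteq> B' g \<longleftrightarrow> g = e" for g
    using arg_cong[OF B'(2), of "\<lambda>A. g \<in> A"] by simp
  hence "B e \<noteq> B' e" and same: "\<And>g. g \<noteq> e \<Longrightarrow> B' g = B g" by metis+
  \<comment> \<open>Both differ from \<open>B\<close> at \<open>e\<close>, so both have the opposite
    sign there.\<close>
  hence "B' e = C e"
    using tope_neq_iff[OF Suc.prems B'(1), of e] tope_neq_iff[OF Suc.prems assms(2), of e] B'(3)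
    by simp
  hence "B' g \<noteq> C g \<longleftrightarrow> B g \<noteq> C g \<and> g \<noteq> e" for g using same[of g] by (cases "g = e") simp_all
  hence "{g. B' g \<noteq> C g} = {g. B g \<noteq> C g} - {e}" by auto
  hence card: "card {g. B' g \<noteq> C g} = n" using Suc.hyps(2) B'(3) by simp
  have "(B, B') \<in> snd (tope_graph L)" using Suc.prems B'(1,2) by (simp add: tope_graph_def)
  moreover have "(B', C) \<in> snd (tope_graph L) ^^ n" using Suc.hyps(1)[of B'] card B'(1) by simp
  ultimately show ?case unfolding Suc.hyps(2)[symmetric] by (rule relpow_Suc_I2)
qed

text \<open>An edge changes one coordinate, so the triangle inequality for the number of
  disagreements bounds walk lengths from below.\<close>

lemma tope_path_length:
  assumes "(B, C) \<in> snd (tope_graph L) ^^ n" "B \<in> topes L"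
  shows "card {e. B e \<noteq> C e} \<le> n"
  using assms(1)
proof (induction n arbitrary: C)
  case 0
  thus ?case by simp
next
  case (Suc n)
  then obtain D where D: "(B, D) \<in> snd (tope_graph L) ^^ n" "(D, C) \<in> snd (tope_graph L)" by auto
  have topes: "D \<in> topes L" "C \<in> topes L" and one: "card {e. D e \<noteq> C e} = 1"
    using D(2) by (auto simp: tope_graph_def)
  have "{e. B e \<noteq> C e} \<subseteq> {e. B e \<noteq> D e} \<union> {e. D e \<noteq> C e}" by auto
  hence "card {e. B e \<noteq> C e} \<le> card ({e. B e \<noteq> D e} \<union> {e. D e \<noteq> C e})"
    using topes assms(2) by (intro card_mono finite_UnI finite_disagreement) (auto simp: topes_iff)
  also have "\<dots> \<le> card {e. B e \<noteq> D e} + card {e. D e \<noteq> C e}" by (rule card_Un_le)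
  finally show ?case using Suc.IH[OF D(1)] one by simp
qed

lemma graph_dist_tope_graph:
  assumes "B \<in> topes L" "C \<in> topes L"
  shows "graph_dist (tope_graph L) B C = card {e. B e \<noteq> C e}"
  unfolding graph_dist_def
  using tope_path[OF assms] tope_path_length[OF _ assms(1)] by (intro Least_equality)

lemma fst_tope_graph: "fst (tope_graph L) = topes L"
  by (simp add: tope_graph_def)

lemma tope_graph_finite_connected:
  "finite (fst (tope_graph L))"
  "B \<in> fst (tope_graph L) \<Longrightarrow> C \<in> fst (tope_graph L) \<Longrightarrow> \<exists>n. (B, C) \<in> snd (tope_graph L) ^^ n"
  using finite_topes tope_path by (auto simp: fst_tope_graph)

lemma is_weighting_tope_graph_iff:
  "is_weighting (tope_graph L) w \<longleftrightarrow>
    (\<forall>B\<in>topes L. (\<Sum>C\<in>topes L. qvar ^ card {e. B e \<noteq> C e} * w C) = 1)"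
  by (simp add: is_weighting_def fst_tope_graph similarity_matrix_def graph_dist_tope_graph)

lemma ex_tope_weighting: "\<exists>w. is_weighting (tope_graph L) w"
  using ex_weighting[OF tope_graph_finite_connected] by blast

lemma magnitude_tope_graph:
  assumes "is_weighting (tope_graph L) w"
  shows "magnitude (tope_graph L) = sum w (topes L)"
  using magnitude_eq_sum_weighting[OF tope_graph_finite_connected assms] by (simp add: fst_tope_graph)

section \<open>Stars of covectors\<close>

text \<open>A tope above \<open>F\<close> is determined off \<open>D\<close> by \<open>F\<close>, so
  only its restriction to \<open>D\<close> is free. A tope of the localization that lifts to
  \<open>X\<close> is hit by \<open>comp_sv F X\<close>.\<close>

lemma star_bij:
  assumes F: "F \<in> L"
  defines "D \<equiv> zero_set E F"
  shows "bij_betw (\<lambda>C. restrict_sv C D) {C \<in> topes L. le_sv F C} (topes (restrict_om L D))"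
proof -
  interpret R: simple_oriented_matroid D "restrict_om L D"
    by (rule simple_restrict_om) (simp add: D_def zero_set_def)
  show ?thesis
  proof (rule bij_betw_imageI)
    show "inj_on (\<lambda>C. restrict_sv C D) {C \<in> topes L. le_sv F C}"
    proof (rule inj_onI, rule ext)
      fix C C' e
      assume C: "C \<in> {C \<in> topes L. le_sv F C}" and C': "C' \<in> {C \<in> topes L. le_sv F C}"
        and eq: "restrict_sv C D = restrict_sv C' D"
      show "C e = C' e"
      proof (cases "e \<in> D")
        case True
        thus ?thesis using restrict_sv_eqD[OF eq True] by (simp add: restrict_sv_def)
      next
        case False
        show ?thesis
        proof (cases "e \<in> E")
          case True
          hence "F e \<noteq> 0" using False by (simp add: D_def zero_set_def)
          thus ?thesis using C C' by (auto simp: le_sv_def) (metis)+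
        next
          case False
          thus ?thesis using C C' covector_outside[of C e] covector_outside[of C' e] by (simp add: topes_iff)
        qed
      qed
    qed
    show "(\<lambda>C. restrict_sv C D) ` {C \<in> topes L. le_sv F C} = topes (restrict_om L D)"
    proof (intro equalityI subsetI)
      fix G assume "G \<in> (\<lambda>C. restrict_sv C D) ` {C \<in> topes L. le_sv F C}"
      then obtain C where C: "C \<in> topes L" "G = restrict_sv C D" by blast
      have "\<forall>e\<in>D. G e \<noteq> 0"
        using C by (simp add: topes_iff restrict_sv_def D_def zero_set_def)
      moreover have "G \<in> restrict_om L D" using C by (simp add: topes_iff)
      ultimately show "G \<in> topes (restrict_om L D)" by (simp add: R.topes_iff)
    next
      fix G assume G: "G \<in> topes (restrict_om L D)"
      then obtain X where X: "X \<in> L" "G = restrict_sv X D" by (auto simp: R.topes_iff)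
      define C where "C = comp_sv F X"
      have "X e \<noteq> 0" if "e \<in> D" for e
      proof -
        have "G e \<noteq> 0" using G that unfolding R.topes_iff by blast
        thus ?thesis using that by (simp add: X(2) restrict_sv_def)
      qed
      hence "C \<in> topes L" using comp_closed[OF F X(1)]
        by (auto simp: C_def topes_iff comp_sv_def D_def zero_set_def)
      moreover have "le_sv F C" by (simp add: le_sv_def C_def comp_sv_def)
      moreover have "restrict_sv C D = G"
        unfolding X(2) by (rule restrict_sv_eqI) (simp add: C_def comp_sv_def D_def zero_set_def)
      ultimately show "G \<in> (\<lambda>C. restrict_sv C D) ` {C \<in> topes L. le_sv F C}" by blast
    qed
  qed
qed

text \<open>Off \<open>D\<close> the tope \<open>C\<close> equals \<open>F\<close>, so the
  disagreements there do not depend on \<open>C\<close>; those on \<open>D\<close> give the distance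
  in the localization. The gate of \<open>B\<close> is \<open>comp_sv F B\<close>.\<close>

lemma star_gate:
  assumes F: "F \<in> L" and B: "B \<in> topes L" and C: "C \<in> topes L" "le_sv F C"
  defines "D \<equiv> zero_set E F"
  shows "card {e. B e \<noteq> C e} =
    card {e \<in> E - D. F e \<noteq> B e} + card {e. restrict_sv B D e \<noteq> restrict_sv C D e}"
proof -
  have out: "B e = 0" "C e = 0" if "e \<notin> E" for e
    using that B C(1) covector_outside by (auto simp: topes_iff)
  have on: "C e = F e" if "e \<in> E - D" for e
    using that C(2) by (auto simp: le_sv_def D_def zero_set_def)
  have D: "D \<subseteq> E" by (auto simp: D_def zero_set_def)
  have "B e \<noteq> C e \<longleftrightarrow> e \<in> E - D \<and> F e \<noteq> B e \<or> restrict_sv B D e \<noteq> restrict_sv C D e" for e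
    using out[of e] on[of e] D by (cases "e \<in> D"; cases "e \<in> E") (auto simp: restrict_sv_def)
  hence "{e. B e \<noteq> C e} = {e \<in> E - D. F e \<noteq> B e} \<union> {e. restrict_sv B D e \<noteq> restrict_sv C D e}"
    by blast
  moreover have "finite {e. restrict_sv B D e \<noteq> restrict_sv C D e}"
    by (rule finite_subset[OF _ finite_ground]) (use D in \<open>auto simp: restrict_sv_def\<close>)
  ultimately show ?thesis
    using finite_ground by (simp add: card_Un_disjoint restrict_sv_def disjoint_iff)
qed

section \<open>A weighting assembled from the stars\<close>

theorem magnitude_tope_graph_localizations:
  "magnitude (tope_graph L) =
    (\<Sum>F\<in>L. (- 1) ^ rank_in L (zero_set E F) * qvar ^ card (zero_set E F)
       * magnitude (tope_graph (restrict_om L (zero_set E F))))"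
proof -
  define D where "D = zero_set E"
  have DE: "D F \<subseteq> E" for F by (auto simp: D_def zero_set_def)
  have simple_loc: "simple_oriented_matroid (D F) (restrict_om L (D F))" for F
    using simple_restrict_om[OF DE] .
  obtain w where w: "\<And>F. is_weighting (tope_graph (restrict_om L (D F))) (w F)"
    using simple_oriented_matroid.ex_tope_weighting[OF simple_loc] by metis
  define c where "c = (\<lambda>F. (- 1) ^ rank_in L (D F) * qvar ^ card (D F))"
  define star where "star = (\<lambda>F. {C \<in> topes L. le_sv F C})"
  \<comment> \<open>The weighting of each localization is pulled back to the star of
    \<open>F\<close>, extended by zero and scaled by its coefficient in the formula.\<close>
  define W where "W = (\<lambda>C. \<Sum>F\<in>L. of_bool (le_sv F C) * (c F * w F (restrict_sv C (D F))))"
  have sum_star: "(\<Sum>C\<in>topes L. of_bool (le_sv F C) * h C) = (\<Sum>C\<in>star F. h C)"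
    for h :: "_ \<Rightarrow> rat poly fract" and F
    unfolding star_def by (rule sum.mono_neutral_cong_right) (auto simp: finite_topes)
  have reindex: "(\<Sum>C\<in>star F. h (restrict_sv C (D F))) = sum h (topes (restrict_om L (D F)))"
    if "F \<in> L" for h :: "_ \<Rightarrow> rat poly fract" and F
    using sum.reindex_bij_betw[OF star_bij[OF that]] by (simp add: star_def D_def)
  have "is_weighting (tope_graph L) W"
    unfolding is_weighting_tope_graph_iff
  proof
    fix B assume B: "B \<in> topes L"
    have "(\<Sum>C\<in>topes L. qvar ^ card {e. B e \<noteq> C e} * W C) =
      (\<Sum>F\<in>L. \<Sum>C\<in>topes L. of_bool (le_sv F C) *
        (qvar ^ card {e. B e \<noteq> C e} * c F * w F (restrict_sv C (D F))))"
      unfolding W_def sum_distrib_left by (subst sum.swap) (simp add: mult_ac)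
    also have "\<dots> = (\<Sum>F\<in>L. (- 1) ^ rank_in L (D F) * qvar ^ card {e \<in> E. F e \<noteq> B e})"
    proof (rule sum.cong[OF refl])
      fix F assume F: "F \<in> L"
      define B' where "B' = restrict_sv B (D F)"
      have B': "B' \<in> topes (restrict_om L (D F))"
      proof -
        have "B \<in> L" "\<forall>e\<in>D F. B' e \<noteq> 0"
          using B DE by (auto simp: topes_iff B'_def restrict_sv_def)
        thus ?thesis
          using simple_oriented_matroid.topes_iff[OF simple_loc[of F]] by (auto simp: B'_def)
      qed
      have "(\<Sum>C\<in>topes L. of_bool (le_sv F C) *
          (qvar ^ card {e. B e \<noteq> C e} * c F * w F (restrict_sv C (D F)))) =
        (\<Sum>C\<in>star F. qvar ^ card {e. B e \<noteq> C e} * c F * w F (restrict_sv C (D F)))"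
        by (rule sum_star)
      \<comment> \<open>The gate property splits off a power of \<open>qvar\<close> independent of
        \<open>C\<close>; what remains is a row of the similarity matrix of the
        localization.\<close>
      also have "\<dots> = (\<Sum>C\<in>star F. c F * qvar ^ card {e \<in> E - D F. F e \<noteq> B e} *
        (qvar ^ card {e. B' e \<noteq> restrict_sv C (D F) e} * w F (restrict_sv C (D F))))"
        using star_gate[OF F B] by (intro sum.cong) (auto simp: star_def D_def B'_def power_add mult_ac)
      also have "\<dots> = c F * qvar ^ card {e \<in> E - D F. F e \<noteq> B e} *
        (\<Sum>G\<in>topes (restrict_om L (D F)). qvar ^ card {e. B' e \<noteq> G e} * w F G)"
        unfolding sum_distrib_left[symmetric] by (subst reindex[OF F, symmetric]) simp
      also have "\<dots> = c F * qvar ^ card {e \<in> E - D F. F e \<noteq> B e}"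
        using w[of F] B' simple_oriented_matroid.is_weighting_tope_graph_iff[OF simple_loc[of F]] by simp
      \<comment> \<open>\<open>B\<close> has no zeros on \<open>D F\<close> while \<open>F\<close>
        vanishes there, so the power of \<open>qvar\<close> in \<open>c F\<close> counts the
        disagreements on \<open>D F\<close>.\<close>
      also have "\<dots> = (- 1) ^ rank_in L (D F) * qvar ^ card {e \<in> E. F e \<noteq> B e}"
      proof -
        have "{e \<in> E. F e \<noteq> B e} = D F \<union> {e \<in> E - D F. F e \<noteq> B e}"
          using B by (auto simp: D_def zero_set_def topes_iff)
        moreover have "finite (D F)" using DE finite_ground finite_subset by blast
        ultimately have "card {e \<in> E. F e \<noteq> B e} = card (D F) + card {e \<in> E - D F. F e \<noteq> B e}"
          using finite_ground by (simp add: card_Un_disjoint disjoint_iff)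
        thus ?thesis by (simp add: c_def power_add mult.assoc)
      qed
      finally show "(\<Sum>C\<in>topes L. of_bool (le_sv F C) *
          (qvar ^ card {e. B e \<noteq> C e} * c F * w F (restrict_sv C (D F)))) =
        (- 1) ^ rank_in L (D F) * qvar ^ card {e \<in> E. F e \<noteq> B e}" .
    qed
    also have "\<dots> = 1"
      using sum_rank_sign_disagreement[of B] B by (simp add: topes_iff D_def)
    finally show "(\<Sum>C\<in>topes L. qvar ^ card {e. B e \<noteq> C e} * W C) = 1" .
  qed
  hence "magnitude (tope_graph L) = (\<Sum>C\<in>topes L. W C)" by (rule magnitude_tope_graph)
  also have "\<dots> = (\<Sum>F\<in>L. \<Sum>C\<in>topes L. of_bool (le_sv F C) * (c F * w F (restrict_sv C (D F))))"
    unfolding W_def by (rule sum.swap)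
  \<comment> \<open>The star bijection turns each inner sum into the total weight of a localization,
    that is, its magnitude.\<close>
  also have "\<dots> = (\<Sum>F\<in>L. c F * sum (w F) (topes (restrict_om L (D F))))"
    unfolding sum_star by (intro sum.cong refl) (simp only: sum_distrib_left[symmetric] reindex)
  also have "\<dots> = (\<Sum>F\<in>L. c F * magnitude (tope_graph (restrict_om L (D F))))"
    using simple_oriented_matroid.magnitude_tope_graph[OF simple_loc w] by simp
  finally show ?thesis by (simp add: c_def D_def)
qed

end

theorem theorem3p4:
  fixes E :: "'e set" and L :: "('e \<Rightarrow> int) set"
  assumes "oriented_matroid E L" and "om_simple E L"
  shows "magnitude (tope_graph L) =
    (\<Sum>F\<in>L. (- 1) ^ om_rank (zero_set E F) (localization E L F) * qvar ^ card (zero_set E F)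
       * magnitude (tope_graph (localization E L F)))"
proof -
  interpret oriented_matroid E L by fact
  interpret simple_oriented_matroid E L by unfold_locales fact
  show ?thesis
    \<comment> \<open>\<open>localization\<close> is \<open>restrict_om\<close> at the zero set, and
      its \<open>om_rank\<close> is the rank of that zero set in \<open>L\<close>.\<close>
    using magnitude_tope_graph_localizations by (simp add: localization_def om_rank_restrict_om)
qed

end
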